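(* In the model described in the context, for either the PS-EH or the TS-EH protocol and any $\rho\in(0,1)$, the throughput $\tau_{in}$ of the incremental relaying scheme is related to the throughput $\tau$ of the cooperative cognitive scheme by $$\tau_{in}=\tau-\tfrac12\zeta R_s\,p_3+\frac{\zeta R_s}{1+\frac{\lambda_{sd}\psi}{\lambda_{sp}}}=\tau+\frac{\tfrac12\zeta R_s}{1+\frac{\lambda_{sd}\psi}{\lambda_{sp}}}\left(1+\Big(1+\frac{\lambda_{sd}\xi}{\lambda_{sr}}+\frac{\lambda_{sp}\xi}{\lambda_{sr}\psi}\Big)^{-L}\right),$$ where $p_3=\Pr[\Gamma_{d_1}\ge\gamma_{th},\ \Gamma_r\ge\gamma_{th}]$.
   Context: Random channel model. Let $L\ge 1$ be an integer (number of relay antennas) and let $\lambda_{sr},\lambda_{rd},\lambda_{sd},\lambda_{sp},\lambda_{rp}>0$. The following random variables are mutually independent complex circular Gaussians: $h^i_{sr}\sim\mathcal{CN}(0,\lambda_{sr}^{-1})$ ($i=1,\dots,L$), $h^j_{rd}\sim\mathcal{CN}(0,\lambda_{rd}^{-1})$ and $g^j_{rp}\sim\mathcal{CN}(0,\lambda_{rp}^{-1})$ ($j=1,\dots,L$), $h_{sd}\sim\mathcal{CN}(0,\lambda_{sd}^{-1})$, $g_{sp}\sim\mathcal{CN}(0,\lambda_{sp}^{-1})$. Thus the squared moduli are independent exponentials with rates $\lambda_{sr},\lambda_{rd},\lambda_{rp},\lambda_{sd},\lambda_{sp}$, respectively. Put $\|\bm h_{sr}\|^2=\sum_{i=1}^L|h^i_{sr}|^2$.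 Constants: interference limit $I>0$, noise power $N_o>0$, harvesting efficiency $\eta\in(0,1]$, target rate $R_s>0$, threshold $\gamma_{th}=2^{2R_s}-1$, and $\psi=\frac{\gamma_{th}}{I/N_o}$. The energy-harvesting parameter is $\rho\in(0,1)$. Protocol-dependent parameters: for power splitting (PS-EH), $\xi=1-\rho$, $\beta=\eta\rho$, $\zeta=1$; for time switching (TS-EH), $\xi=1$, $\beta=\frac{2\eta\rho}{1-\rho}$, $\zeta=1-\rho$. Source power: $P_s=I/|g_{sp}|^2$. SNRs: $$\Gamma_r=\frac{\xi P_s\|\bm h_{sr}\|^2}{N_o},\qquad \Gamma_{d_1}=\frac{P_s|h_{sd}|^2}{N_o},\qquad \Gamma_d^{j}=\frac{1}{N_o}\min\Big(\beta P_s\|\bm h_{sr}\|^2,\frac{I}{|g^j_{rp}|^2}\Big)|h^j_{rd}|^2+\Gamma_{d_1}.$$ The selected relay antenna is $\hat j=\arg\max_j\Gamma_d^j$. Cooperative scheme: outage $p=\Pr[\min(\Gamma_r,\Gamma_d^{\hat j})<\gamma_{th}]$, throughput $\tau=\tfrac12R_s\zeta(1-p)$. Incremental relaying scheme: throughput $$\tau_{in}=\zeta\Big(\tfrac12R_s\Pr\big[\Gamma_{d_1}<\gamma_{th},\ \Gamma_r\ge\gamma_{th},\ \Gamma_d^{\hat j}\ge\gamma_{th}\big]+R_s\Pr[\Gamma_{d_1}\ge\gamma_{th}]\Big).$$ *)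

theory Defs
  imports "HOL-Probability.Probability"
begin

text \<open>Density, with respect to Lebesgue measure on the complex plane, of the circularly symmetric
  complex Gaussian distribution of mean 0 and variance v, where the variance is the expectation of
  the squared modulus (so the real and the imaginary part each have variance v / 2).\<close>

definition complex_normal_density :: "real \<Rightarrow> complex \<Rightarrow> real" where
  "complex_normal_density v z = exp (- (cmod z)\<^sup>2 / v) / (pi * v)"

text \<open>The subscripts s, r, d, p stand for the source, the relay, the destination and the primary
  user. Relay antennas are numbered from 1 to \<open>antennas\<close>; the values of the
  antenna-indexed coefficients at other indices are irrelevant.\<close>

record 'a relay_system =
  prob_sp :: "'a measure"
  antennas :: nat
  lam_sr :: real
  lam_rd :: real
  lam_sd :: real
  lam_sp :: real
  lam_rp :: real
  h_sr :: "nat \<Rightarrow> 'a \<Rightarrow> complex"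
  h_rd :: "nat \<Rightarrow> 'a \<Rightarrow> complex"
  g_rp :: "nat \<Rightarrow> 'a \<Rightarrow> complex"
  h_sd :: "'a \<Rightarrow> complex"
  g_sp :: "'a \<Rightarrow> complex"
  interference_limit :: real
  noise_power :: real
  efficiency :: real
  target_rate :: real

text \<open>All channel coefficients are collected into one family, indexed by the type below, in
  order to state that they are mutually independent.\<close>

datatype link = SR nat | RD nat | RP nat | SD | SP

definition links :: "nat \<Rightarrow> link set" where
  "links L = SR ` {1..L} \<union> RD ` {1..L} \<union> RP ` {1..L} \<union> {SD, SP}"

primrec coefficient :: "'a relay_system \<Rightarrow> link \<Rightarrow> 'a \<Rightarrow> complex" where
  "coefficient S (SR i) = h_sr S i"
| "coefficient S (RD j) = h_rd S j"
| "coefficient S (RP j) = g_rp S j"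
| "coefficient S SD = h_sd S"
| "coefficient S SP = g_sp S"

primrec rate :: "'a relay_system \<Rightarrow> link \<Rightarrow> real" where
  "rate S (SR i) = lam_sr S"
| "rate S (RD j) = lam_rd S"
| "rate S (RP j) = lam_rp S"
| "rate S SD = lam_sd S"
| "rate S SP = lam_sp S"

definition channel_model :: "'a relay_system \<Rightarrow> bool" where
  "channel_model S \<longleftrightarrow>
     prob_space (prob_sp S) \<and> antennas S \<ge> 1 \<and>
     lam_sr S > 0 \<and> lam_rd S > 0 \<and> lam_sd S > 0 \<and> lam_sp S > 0 \<and> lam_rp S > 0 \<and>
     (\<forall>l\<in>links (antennas S).
        distributed (prob_sp S) lborel (coefficient S l) (complex_normal_density (1 / rate S l))) \<and>
     prob_space.indep_vars (prob_sp S) (\<lambda>_. borel) (coefficient S) (links (antennas S)) \<and>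
     interference_limit S > 0 \<and> noise_power S > 0 \<and>
     0 < efficiency S \<and> efficiency S \<le> 1 \<and> target_rate S > 0"

definition gamma_th :: "'a relay_system \<Rightarrow> real" where
  "gamma_th S = 2 powr (2 * target_rate S) - 1"

definition psi :: "'a relay_system \<Rightarrow> real" where
  "psi S = gamma_th S / (interference_limit S / noise_power S)"

text \<open>Energy harvesting at the relay: power splitting or time switching, with parameter \<open>\<rho>\<close>.\<close>

datatype protocol = PS_EH | TS_EH

primrec xi :: "protocol \<Rightarrow> real \<Rightarrow> real" where
  "xi PS_EH \<rho> = 1 - \<rho>"
| "xi TS_EH \<rho> = 1"

primrec beta :: "'a relay_system \<Rightarrow> protocol \<Rightarrow> real \<Rightarrow> real" where
  "beta S PS_EH \<rho> = efficiency S * \<rho>"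
| "beta S TS_EH \<rho> = 2 * efficiency S * \<rho> / (1 - \<rho>)"

primrec zeta :: "protocol \<Rightarrow> real \<Rightarrow> real" where
  "zeta PS_EH \<rho> = 1"
| "zeta TS_EH \<rho> = 1 - \<rho>"

text \<open>Where \<open>g_sp\<close> or \<open>g_rp\<close> vanishes, which happens with probability 0, the quotients below
  take the value 0.\<close>

definition source_power :: "'a relay_system \<Rightarrow> 'a \<Rightarrow> real" where
  "source_power S \<omega> = interference_limit S / (cmod (g_sp S \<omega>))\<^sup>2"

definition sr_gain :: "'a relay_system \<Rightarrow> 'a \<Rightarrow> real" where
  "sr_gain S \<omega> = (\<Sum>i\<in>{1..antennas S}. (cmod (h_sr S i \<omega>))\<^sup>2)"

definition snr_relay :: "'a relay_system \<Rightarrow> protocol \<Rightarrow> real \<Rightarrow> 'a \<Rightarrow> real" where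
  "snr_relay S eh \<rho> \<omega> = xi eh \<rho> * source_power S \<omega> * sr_gain S \<omega> / noise_power S"

definition snr_direct :: "'a relay_system \<Rightarrow> 'a \<Rightarrow> real" where
  "snr_direct S \<omega> = source_power S \<omega> * (cmod (h_sd S \<omega>))\<^sup>2 / noise_power S"

definition snr_dest :: "'a relay_system \<Rightarrow> protocol \<Rightarrow> real \<Rightarrow> nat \<Rightarrow> 'a \<Rightarrow> real" where
  "snr_dest S eh \<rho> j \<omega> =
     1 / noise_power S *
       min (beta S eh \<rho> * source_power S \<omega> * sr_gain S \<omega>)
           (interference_limit S / (cmod (g_rp S j \<omega>))\<^sup>2) *
       (cmod (h_rd S j \<omega>))\<^sup>2
     + snr_direct S \<omega>"

definition best_antenna :: "'a relay_system \<Rightarrow> protocol \<Rightarrow> real \<Rightarrow> 'a \<Rightarrow> nat" where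
  "best_antenna S eh \<rho> \<omega> = arg_max_on (\<lambda>j. snr_dest S eh \<rho> j \<omega>) {1..antennas S}"

definition snr_best :: "'a relay_system \<Rightarrow> protocol \<Rightarrow> real \<Rightarrow> 'a \<Rightarrow> real" where
  "snr_best S eh \<rho> \<omega> = snr_dest S eh \<rho> (best_antenna S eh \<rho> \<omega>) \<omega>"

definition outage :: "'a relay_system \<Rightarrow> protocol \<Rightarrow> real \<Rightarrow> real" where
  "outage S eh \<rho> =
     \<P>(\<omega> in prob_sp S. min (snr_relay S eh \<rho> \<omega>) (snr_best S eh \<rho> \<omega>) < gamma_th S)"

definition throughput :: "'a relay_system \<Rightarrow> protocol \<Rightarrow> real \<Rightarrow> real" where
  "throughput S eh \<rho> = 1 / 2 * target_rate S * zeta eh \<rho> * (1 - outage S eh \<rho>)"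

definition incremental_throughput :: "'a relay_system \<Rightarrow> protocol \<Rightarrow> real \<Rightarrow> real" where
  "incremental_throughput S eh \<rho> =
     zeta eh \<rho> *
       (1 / 2 * target_rate S *
          \<P>(\<omega> in prob_sp S. snr_direct S \<omega> < gamma_th S \<and>
              snr_relay S eh \<rho> \<omega> \<ge> gamma_th S \<and> snr_best S eh \<rho> \<omega> \<ge> gamma_th S)
        + target_rate S * \<P>(\<omega> in prob_sp S. snr_direct S \<omega> \<ge> gamma_th S))"

definition p3 :: "'a relay_system \<Rightarrow> protocol \<Rightarrow> real \<Rightarrow> real" where
  "p3 S eh \<rho> =
     \<P>(\<omega> in prob_sp S. snr_direct S \<omega> \<ge> gamma_th S \<and> snr_relay S eh \<rho> \<omega> \<ge> gamma_th S)"

end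

theory Submission
  imports Defs
begin

text \<open>The selected antenna only adds to the direct SNR, so when the direct link succeeds the cooperative
  scheme is in outage only if the relay fails to decode. Hence the success probability \<open>1 - p\<close> is the
  probability weighted by \<open>1 / 2\<close> in the incremental throughput, plus \<open>p\<^sub>3\<close>. Almost surely
  \<open>\<Gamma>\<^bsub>d\<^sub>1\<^esub> \<ge> \<gamma>\<^bsub>th\<^esub>\<close> means \<open>Y \<ge> \<psi> X\<close> and \<open>\<Gamma>\<^sub>r \<ge> \<gamma>\<^bsub>th\<^esub>\<close> means \<open>X \<le> (\<xi> / \<psi>) Z\<close>, where \<open>X = |g\<^bsub>sp\<^esub>|\<^sup>2\<close>,
  \<open>Y = |h\<^bsub>sd\<^esub>|\<^sup>2\<close> are independent exponentials and \<open>Z = \<parallel>h\<^bsub>sr\<^esub>\<parallel>\<^sup>2\<close> is an independent sum of exponentials;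
  integrating out \<open>Y\<close> and then \<open>X\<close> leaves the Laplace transform of \<open>Z\<close>.\<close>

section \<open>The squared modulus of a circular Gaussian\<close>

text \<open>The preimage of \<open>{..a}\<close> with \<open>0 \<le> a\<close> is the disc of radius
  \<open>sqrt a\<close>, of area \<open>pi * a\<close>; for negative \<open>a\<close> it is empty.
  Half-lines form an intersection-stable generator of the Borel sets, so agreement on them
  suffices.\<close>

lemma distr_lborel_cmod_square:
  "distr lborel borel (\<lambda>z. (cmod z)\<^sup>2) = density lborel (\<lambda>x. ennreal pi * indicator {0..} x)"
    (is "?D = ?R")
proof (rule measure_eqI_generator_eq[where E = "range atMost" and A = "\<lambda>n. {..real n}"])
  have eq: "emeasure ?D {..a} = ennreal (pi * max 0 a)" for a :: real
  proof (cases "a < 0")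
    case True
    then have "(\<lambda>z. (cmod z)\<^sup>2) -` {..a} = {}"
      by (auto dest: order_trans[OF zero_le_power2])
    with True show ?thesis by (simp add: emeasure_distr)
  next
    case False
    then have "(\<lambda>z. (cmod z)\<^sup>2) -` {..a} = cball 0 (sqrt a)"
      by (auto simp: real_le_rsqrt real_le_lsqrt sqrt_le_D) (metis abs_norm_cancel not_less real_sqrt_abs real_sqrt_le_iff sqrt_le_D real_sqrt_le_mono)
    with False show ?thesis
      by (simp add: emeasure_distr emeasure_cball unit_ball_vol_2)
  qed
  have eq': "emeasure ?R {..a} = ennreal (pi * max 0 a)" for a :: real
  proof -
    have "emeasure ?R {..a} = (\<integral>\<^sup>+x. ennreal pi * indicator {0..a} x \<partial>lborel)"
      by (auto simp: emeasure_density intro!: nn_integral_cong split: split_indicator)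
    also have "\<dots> = ennreal pi * emeasure lborel {0..a}"
      by (rule nn_integral_cmult_indicator) simp
    also have "\<dots> = ennreal (pi * max 0 a)"
      by (cases "0 \<le> a") (auto simp: ennreal_mult)
    finally show ?thesis .
  qed
  show "emeasure ?D X = emeasure ?R X" if "X \<in> range atMost" for X
    using that eq eq' by auto
  show "Int_stable (range (atMost :: real \<Rightarrow> _))"
    by (auto simp: Int_stable_def intro!: exI[of _ "min _ _"])
  show "sets ?D = sigma_sets UNIV (range atMost)" "sets ?R = sigma_sets UNIV (range atMost)"
    by (auto simp: borel_eq_atMost)
  show "(\<Union>n. {..real n}) = UNIV"
    by (auto intro: real_arch_simple)
  show "emeasure ?D {..real n} \<noteq> \<infinity>" for n
    by (simp add: eq)
qed auto

text \<open>The Gaussian density depends on \<open>z\<close> only through its squared modulus, so it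
  has the form \<open>g\<close> composed with that map. The image law then has density
  \<open>g\<close> with respect to the image of Lebesgue measure, which is \<open>pi\<close> times
  Lebesgue measure on the half-line; this \<open>pi\<close> cancels the one in the Gaussian
  normalisation.\<close>

lemma distributed_cmod_square:
  assumes "distributed M lborel h (complex_normal_density (1 / l))" and "0 < l"
  shows "distributed M lborel (\<lambda>\<omega>. (cmod (h \<omega>))\<^sup>2) (exponential_density l)"
proof -
  have h[measurable]: "h \<in> borel_measurable M"
    using distributed_measurable[OF assms(1)] by simp
  define g where "g x = ennreal (exp (- x * l) * l / pi)" for x
  have [measurable]: "g \<in> borel_measurable borel"
    unfolding g_def[abs_def] by measurable
  have "distr M lborel (\<lambda>\<omega>. (cmod (h \<omega>))\<^sup>2) = distr (distr M lborel h) borel (\<lambda>z. (cmod z)\<^sup>2)"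
    by (subst distr_distr) (auto simp: comp_def cong: distr_cong)
  also have "\<dots> = distr (density lborel (\<lambda>z. g ((cmod z)\<^sup>2))) borel (\<lambda>z. (cmod z)\<^sup>2)"
    using distributed_distr_eq_density[OF assms(1)]
    by (simp add: g_def complex_normal_density_def)
  also have "\<dots> = density (density lborel (\<lambda>x. ennreal pi * indicator {0..} x)) g"
    by (simp add: density_distr flip: distr_lborel_cmod_square)
  also have "\<dots> = density lborel (exponential_density l)"
    using \<open>0 < l\<close>
    by (subst density_density_eq)
       (auto simp: g_def exponential_density_def simp flip: ennreal_mult
         intro!: density_cong split: split_indicator)
  finally show ?thesis
    by (simp add: distributed_def)
qed

section \<open>Probabilities as expectations, and Fubini for independent pairs\<close>

lemma (in prob_space) prob_eq_expectation_of_bool: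
  assumes "{\<omega>\<in>space M. P \<omega>} \<in> events"
  shows "\<P>(\<omega> in M. P \<omega>) = expectation (\<lambda>\<omega>. of_bool (P \<omega>))"
proof -
  have "expectation (\<lambda>\<omega>. of_bool (P \<omega>)) = expectation (indicator {\<omega>\<in>space M. P \<omega>} :: 'a \<Rightarrow> real)"
    by (intro Bochner_Integration.integral_cong) auto
  then show ?thesis
    using assms by simp
qed

text \<open>Fubini on the product of the two laws, pulled back to the original space; the second
  sample point \<open>\<omega>'\<close> plays the independent copy. Independence enters as a product
  law \<open>D\<close>, with arbitrary target spaces, so that \<open>W\<close> may itself be a pair.
  Boundedness gives integrability.\<close>

lemma (in prob_space) expectation_product_distr:
  fixes f :: "'b \<times> 'c \<Rightarrow> real"
  assumes [measurable]: "random_variable S W" "random_variable T Y"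
    and D: "distr M S W \<Otimes>\<^sub>M distr M T Y = distr M (S \<Otimes>\<^sub>M T) (\<lambda>\<omega>. (W \<omega>, Y \<omega>))"
    and [measurable]: "f \<in> borel_measurable (S \<Otimes>\<^sub>M T)"
    and bound: "\<And>p. \<bar>f p\<bar> \<le> B"
  shows "expectation (\<lambda>\<omega>. f (W \<omega>, Y \<omega>)) =
    expectation (\<lambda>\<omega>. expectation (\<lambda>\<omega>'. f (W \<omega>, Y \<omega>')))"
proof -
  interpret W: prob_space "distr M S W" by (rule prob_space_distr) simp
  interpret Y: prob_space "distr M T Y" by (rule prob_space_distr) simp
  interpret WY: pair_prob_space "distr M S W" "distr M T Y" ..
  have "expectation (\<lambda>\<omega>. f (W \<omega>, Y \<omega>)) = (\<integral>p. f p \<partial>(distr M S W \<Otimes>\<^sub>M distr M T Y))"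
    unfolding D by (subst integral_distr) auto
  also have "\<dots> = (\<integral>w. \<integral>y. f (w, y) \<partial>distr M T Y \<partial>distr M S W)"
    by (intro WY.integral_fst'[symmetric] WY.integrable_const_bound[where B = B])
       (auto simp: bound)
  also have "\<dots> = (\<integral>w. expectation (\<lambda>\<omega>'. f (w, Y \<omega>')) \<partial>distr M S W)"
    by (intro Bochner_Integration.integral_cong refl, subst integral_distr) auto
  also have "\<dots> = expectation (\<lambda>\<omega>. expectation (\<lambda>\<omega>'. f (W \<omega>, Y \<omega>')))"
    by (subst integral_distr) auto
  finally show ?thesis .
qed

section \<open>Null events, tails and Laplace transforms of exponential variables\<close>

text \<open>Lebesgue measure gives points no mass, hence neither does a law with a density. This
  makes strict and weak tails agree and discards the event that \<open>g_sp\<close>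
  vanishes.\<close>

lemma distributed_lborel_AE_neq:
  fixes X :: "'a \<Rightarrow> real"
  assumes "distributed M lborel X f"
  shows "AE \<omega> in M. X \<omega> \<noteq> a"
proof -
  have "AE x in density lborel f. x \<noteq> a"
    using AE_lborel_singleton[of a] distributed_borel_measurable[OF assms]
    by (subst AE_density) auto
  then have "AE x in distr M lborel X. x \<noteq> a"
    by (subst distributed_distr_eq_density[OF assms])
  then show ?thesis
    using distributed_measurable[OF assms] by (subst (asm) AE_distr_iff) auto
qed

lemma (in prob_space) exponential_distributedD_ge:
  assumes D: "distributed M lborel X (exponential_density l)" and "0 \<le> a" and "0 < l"
  shows "\<P>(x in M. a \<le> X x) = exp (- a * l)"
proof -
  have [measurable]: "X \<in> borel_measurable M"
    using distributed_measurable[OF D] by simp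
  have "\<P>(x in M. a \<le> X x) = \<P>(x in M. a < X x)"
    using distributed_lborel_AE_neq[OF D, of a] by (intro prob_eq_AE) auto
  with exponential_distributedD_gt[OF assms] show ?thesis by simp
qed

text \<open>Multiplying the density of rate \<open>a\<close> by \<open>exp (- b * x)\<close> gives
  \<open>a / (a + b)\<close> times the density of rate \<open>a + b\<close>, whose total mass is
  1.\<close>

lemma (in prob_space) exponential_laplace_transform:
  assumes D: "distributed M lborel X (exponential_density a)" and "0 < a" and "0 \<le> b"
  shows "expectation (\<lambda>\<omega>. exp (- b * X \<omega>)) = a / (a + b)"
proof -
  define c where "c = a + b"
  have c: "0 < c" and exp_c: "exp (- x * a) * exp (- b * x) = exp (- x * c)" for x
    using assms by (simp_all add: c_def algebra_simps flip: exp_add)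
  interpret E: prob_space "density lborel (exponential_density c)"
    using c by (intro prob_space_exponential_density) simp
  have nonneg: "0 \<le> exponential_density c x" for x
    using c by (simp add: exponential_density_nonneg)
  have "expectation (\<lambda>\<omega>. exp (- b * X \<omega>)) =
      (\<integral>x. exponential_density a x * exp (- b * x) \<partial>lborel)"
    using assms by (intro distributed_integral[OF D, symmetric]) (auto simp: exponential_density_nonneg)
  also have "\<dots> = (\<integral>x. a / c * exponential_density c x \<partial>lborel)"
    using c exp_c by (intro Bochner_Integration.integral_cong) (auto simp: exponential_density_def)
  also have "\<dots> = a / c * (\<integral>x. 1 \<partial>density lborel (exponential_density c))"
    using nonneg by (subst integral_density) auto
  also have "\<dots> = a / c"
    by (simp add: E.prob_space[simplified])
  finally show ?thesis
    by (simp add: c_def)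
qed

text \<open>The same merging of exponents, now over the bounded interval from 0 to \<open>t\<close>,
  where the fundamental theorem of calculus with the antiderivative \<open>?F\<close> evaluates the
  integral.\<close>

lemma (in prob_space) exponential_truncated_laplace_transform:
  assumes D: "distributed M lborel X (exponential_density a)" and "0 < a" and "0 \<le> b" and "0 \<le> t"
  shows "expectation (\<lambda>\<omega>. exp (- b * X \<omega>) * of_bool (X \<omega> \<le> t)) =
    a / (a + b) * (1 - exp (- (a + b) * t))"
proof -
  define c where "c = a + b"
  have c: "0 < c" and exp_c: "exp (- x * a) * exp (- b * x) = exp (- c * x)" for x
    using assms by (simp_all add: c_def algebra_simps flip: exp_add)
  let ?F = "\<lambda>x. - (a / c) * exp (- c * x)"
  have "expectation (\<lambda>\<omega>. exp (- b * X \<omega>) * of_bool (X \<omega> \<le> t)) =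
      (\<integral>x. exponential_density a x * (exp (- b * x) * of_bool (x \<le> t)) \<partial>lborel)"
    using assms by (intro distributed_integral[OF D, symmetric]) (auto simp: exponential_density_nonneg)
  also have "\<dots> = (\<integral>x. a * exp (- c * x) * indicator {0..t} x \<partial>lborel)"
    using exp_c by (intro Bochner_Integration.integral_cong) (auto simp: exponential_density_def)
  also have "\<dots> = ?F t - ?F 0"
    using c \<open>0 \<le> t\<close>
    by (intro integral_FTC_Icc_real)
       (auto intro!: derivative_eq_intros continuous_intros)
  finally show ?thesis
    by (simp add: c_def algebra_simps)
qed


section \<open>Comparisons of independent variables\<close>

text \<open>Conditioning on \<open>X\<close> turns the event \<open>k * X \<le> Y\<close> into the factor \<open>exp (- b * k * X)\<close>, which
  merges with the density of \<open>X\<close>.\<close>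

lemma (in prob_space) prob_exponential_ratio_ge:
  assumes X: "distributed M lborel X (exponential_density a)" "0 < a" "\<And>\<omega>. 0 \<le> X \<omega>"
    and Y: "distributed M lborel Y (exponential_density b)" "0 < b"
    and ind: "distr M borel X \<Otimes>\<^sub>M distr M borel Y = distr M (borel \<Otimes>\<^sub>M borel) (\<lambda>\<omega>. (X \<omega>, Y \<omega>))" and "0 \<le> k"
  shows "\<P>(\<omega> in M. k * X \<omega> \<le> Y \<omega>) = a / (a + b * k)"
proof -
  have [measurable]: "X \<in> borel_measurable M" "Y \<in> borel_measurable M"
    using distributed_measurable[OF X(1)] distributed_measurable[OF Y(1)] by simp_all
  have "\<P>(\<omega> in M. k * X \<omega> \<le> Y \<omega>) = expectation (\<lambda>\<omega>. of_bool (k * X \<omega> \<le> Y \<omega>))"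
    by (rule prob_eq_expectation_of_bool) simp
  also have "\<dots> = expectation (\<lambda>\<omega>. expectation (\<lambda>\<omega>'. of_bool (k * X \<omega> \<le> Y \<omega>')))"
    using expectation_product_distr[OF _ _ ind, of "\<lambda>p. of_bool (k * fst p \<le> snd p)" 1] by simp
  also have "\<dots> = expectation (\<lambda>\<omega>. exp (- (b * k) * X \<omega>))"
    using assms
    by (intro Bochner_Integration.integral_cong refl, subst prob_eq_expectation_of_bool[symmetric])
       (auto simp: exponential_distributedD_ge mult_ac)
  also have "\<dots> = a / (a + b * k)"
    using assms by (intro exponential_laplace_transform) auto
  finally show ?thesis .
qed

text \<open>Three integrations in turn. Given \<open>X\<close> and \<open>Z\<close>, the tail of
  \<open>Y\<close> contributes \<open>exp (- (b * k) * X)\<close>; given \<open>Z\<close>, averaging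
  over \<open>X\<close> is a Laplace transform truncated at \<open>c * Z\<close>; what remains is
  the Laplace transform of \<open>Z\<close>. Hence independence is required of \<open>Y\<close> from
  the pair of \<open>X\<close> and \<open>Z\<close>, and of \<open>X\<close> from
  \<open>Z\<close>.\<close>

lemma (in prob_space) prob_exponential_ratio_ge_le:
  assumes X: "distributed M lborel X (exponential_density a)" "0 < a" "\<And>\<omega>. 0 \<le> X \<omega>"
    and Y: "distributed M lborel Y (exponential_density b)" "0 < b"
    and Z[measurable]: "random_variable borel Z" "\<And>\<omega>. 0 \<le> Z \<omega>"
    and ind_XZ: "distr M borel Z \<Otimes>\<^sub>M distr M borel X = distr M (borel \<Otimes>\<^sub>M borel) (\<lambda>\<omega>. (Z \<omega>, X \<omega>))"
    and ind_Y: "distr M (borel \<Otimes>\<^sub>M borel) (\<lambda>\<omega>. (X \<omega>, Z \<omega>)) \<Otimes>\<^sub>M distr M borel Y =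
      distr M ((borel \<Otimes>\<^sub>M borel) \<Otimes>\<^sub>M borel) (\<lambda>\<omega>. ((X \<omega>, Z \<omega>), Y \<omega>))"
    and "0 \<le> k" and "0 \<le> c"
  shows "\<P>(\<omega> in M. k * X \<omega> \<le> Y \<omega> \<and> X \<omega> \<le> c * Z \<omega>) =
    a / (a + b * k) * (1 - expectation (\<lambda>\<omega>. exp (- ((a + b * k) * c) * Z \<omega>)))"
proof -
  have [measurable]: "X \<in> borel_measurable M" "Y \<in> borel_measurable M"
    using distributed_measurable[OF X(1)] distributed_measurable[OF Y(1)] by simp_all
  \<comment> \<open>The \<open>max 0 x\<close> keeps \<open>f\<close> bounded by 1 on all reals, as
    Fubini demands; it changes nothing at the nonnegative values of \<open>X\<close>.\<close>
  define f where "f x z = exp (- (b * k) * max 0 x) * of_bool (x \<le> c * z)" for x z :: real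
  have "\<P>(\<omega> in M. k * X \<omega> \<le> Y \<omega> \<and> X \<omega> \<le> c * Z \<omega>) =
      expectation (\<lambda>\<omega>. of_bool (k * X \<omega> \<le> Y \<omega> \<and> X \<omega> \<le> c * Z \<omega>))"
    by (rule prob_eq_expectation_of_bool) simp
  also have "\<dots> = expectation (\<lambda>\<omega>. expectation (\<lambda>\<omega>'. of_bool (k * X \<omega> \<le> Y \<omega>' \<and> X \<omega> \<le> c * Z \<omega>)))"
    using expectation_product_distr[OF _ _ ind_Y,
        of "\<lambda>p. of_bool (k * fst (fst p) \<le> snd p \<and> fst (fst p) \<le> c * snd (fst p))" 1]
    by simp
  also have "\<dots> = expectation (\<lambda>\<omega>. f (X \<omega>) (Z \<omega>))"
  proof (rule Bochner_Integration.integral_cong)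
    fix \<omega>
    have "expectation (\<lambda>\<omega>'. of_bool (k * X \<omega> \<le> Y \<omega>')) = exp (- (b * k) * X \<omega>)"
      using assms
      by (subst prob_eq_expectation_of_bool[symmetric])
         (auto simp: exponential_distributedD_ge mult_ac)
    then show "expectation (\<lambda>\<omega>'. of_bool (k * X \<omega> \<le> Y \<omega>' \<and> X \<omega> \<le> c * Z \<omega>)) = f (X \<omega>) (Z \<omega>)"
      using X(3)[of \<omega>] by (cases "X \<omega> \<le> c * Z \<omega>") (simp_all add: f_def)
  qed simp
  \<comment> \<open>Now \<open>Z\<close> is the outer variable, which explains the order of the pair
    in \<open>ind_XZ\<close> and the swapped projections below.\<close>
  also have "\<dots> = expectation (\<lambda>\<omega>. expectation (\<lambda>\<omega>'. f (X \<omega>') (Z \<omega>)))"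
  proof -
    have "\<bar>f x z\<bar> \<le> 1" for x z
      using \<open>0 < b\<close> \<open>0 \<le> k\<close> by (auto simp: f_def)
    moreover have "(\<lambda>p. f (snd p) (fst p)) \<in> borel_measurable (borel \<Otimes>\<^sub>M borel)"
      unfolding f_def by measurable
    ultimately show ?thesis
      using expectation_product_distr[OF _ _ ind_XZ, of "\<lambda>p. f (snd p) (fst p)" 1] by simp
  qed
  also have "\<dots> = expectation (\<lambda>\<omega>. a / (a + b * k) * (1 - exp (- ((a + b * k) * c) * Z \<omega>)))"
  proof (rule Bochner_Integration.integral_cong)
    fix \<omega>
    have "expectation (\<lambda>\<omega>'. f (X \<omega>') (Z \<omega>)) =
        expectation (\<lambda>\<omega>'. exp (- (b * k) * X \<omega>') * of_bool (X \<omega>' \<le> c * Z \<omega>))"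
      using X(3) by (simp add: f_def)
    also have "\<dots> = a / (a + b * k) * (1 - exp (- (a + b * k) * (c * Z \<omega>)))"
      using assms by (intro exponential_truncated_laplace_transform) auto
    finally show "expectation (\<lambda>\<omega>'. f (X \<omega>') (Z \<omega>)) =
        a / (a + b * k) * (1 - exp (- ((a + b * k) * c) * Z \<omega>))"
      by (simp only: mult.assoc mult_minus_left)
  qed simp
  also have "\<dots> = a / (a + b * k) * (1 - expectation (\<lambda>\<omega>. exp (- ((a + b * k) * c) * Z \<omega>)))"
  proof -
    have "integrable M (\<lambda>\<omega>. exp (- ((a + b * k) * c) * Z \<omega>))"
      using assms by (intro integrable_const_bound[where B = 1]) auto
    then show ?thesis
      by (simp add: prob_space)
  qed
  finally show ?thesis .
qed

section \<open>Independent families: sums and disjoint blocks\<close>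

text \<open>The exponential turns the sum into a product, and independence turns the expectation of
  the product into a product of equal factors \<open>a / (a + s)\<close>.\<close>

lemma (in prob_space) laplace_transform_sum_exponential:
  assumes "finite I" and X: "\<And>i. i \<in> I \<Longrightarrow> distributed M lborel (X i) (exponential_density a)"
    and ind: "indep_vars (\<lambda>_. borel) X I"
    and nonneg: "\<And>i \<omega>. i \<in> I \<Longrightarrow> 0 \<le> X i \<omega>" and "0 < a" and "0 \<le> s"
  shows "expectation (\<lambda>\<omega>. exp (- s * (\<Sum>i\<in>I. X i \<omega>))) = (a / (a + s)) ^ card I"
proof -
  have [measurable]: "X i \<in> borel_measurable M" if "i \<in> I" for i
    using distributed_measurable[OF X[OF that]] by simp
  have "expectation (\<lambda>\<omega>. exp (- s * (\<Sum>i\<in>I. X i \<omega>))) = expectation (\<lambda>\<omega>. \<Prod>i\<in>I. exp (- s * X i \<omega>))"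
    using \<open>finite I\<close> by (simp add: exp_sum sum_distrib_left sum_negf[symmetric])
  also have "\<dots> = (\<Prod>i\<in>I. expectation (\<lambda>\<omega>. exp (- s * X i \<omega>)))"
  proof (rule indep_vars_lebesgue_integral)
    show "indep_vars (\<lambda>_. borel) (\<lambda>i \<omega>. exp (- s * X i \<omega>)) I"
      using indep_vars_compose2[OF ind, of "\<lambda>_ x. exp (- s * x)" "\<lambda>_. borel"] by simp
    show "integrable M (\<lambda>\<omega>. exp (- s * X i \<omega>))" if "i \<in> I" for i
      using that nonneg \<open>0 \<le> s\<close> by (intro integrable_const_bound[where B = 1]) auto
  qed fact
  also have "\<dots> = (\<Prod>i\<in>I. a / (a + s))"
    using assms by (intro prod.cong refl exponential_laplace_transform) auto
  finally show ?thesis by simp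
qed

text \<open>Disjoint blocks of an independent family have a product law; its image under
  \<open>f\<close> and \<open>g\<close> acting coordinatewise is again a product. The conclusion has
  the shape that \<open>expectation_product_distr\<close> takes as its hypothesis
  \<open>D\<close>.\<close>

lemma (in prob_space) distr_pair_functions_restrict:
  assumes ind: "indep_vars M' X I" and AB: "A \<inter> B = {}" "A \<subseteq> I" "B \<subseteq> I"
    and [measurable]: "f \<in> PiM A M' \<rightarrow>\<^sub>M S" "g \<in> PiM B M' \<rightarrow>\<^sub>M T"
  defines "W \<equiv> \<lambda>\<omega>. f (\<lambda>i\<in>A. X i \<omega>)" and "Y \<equiv> \<lambda>\<omega>. g (\<lambda>i\<in>B. X i \<omega>)"
  shows "distr M S W \<Otimes>\<^sub>M distr M T Y = distr M (S \<Otimes>\<^sub>M T) (\<lambda>\<omega>. (W \<omega>, Y \<omega>))"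
proof -
  let ?A = "\<lambda>\<omega>. \<lambda>i\<in>A. X i \<omega>" and ?B = "\<lambda>\<omega>. \<lambda>i\<in>B. X i \<omega>"
  have [measurable]: "random_variable (PiM A M') ?A" "random_variable (PiM B M') ?B"
    and D: "distr M (PiM A M') ?A \<Otimes>\<^sub>M distr M (PiM B M') ?B =
      distr M (PiM A M' \<Otimes>\<^sub>M PiM B M') (\<lambda>\<omega>. (?A \<omega>, ?B \<omega>))"
    using indep_var_restrict[OF ind AB] by (auto simp: indep_var_distribution_eq)
  have W: "distr M S W = distr (distr M (PiM A M') ?A) S f"
    and Y: "distr M T Y = distr (distr M (PiM B M') ?B) T g"
    by (simp_all add: W_def Y_def distr_distr comp_def)
  have "random_variable T Y"
    unfolding Y_def by measurable
  \<comment> \<open>A side condition of \<open>pair_measure_distr\<close>.\<close>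
  then have "sigma_finite_measure (distr M T Y)"
    by (simp add: prob_space_distr prob_space_imp_sigma_finite)
  then have "distr M S W \<Otimes>\<^sub>M distr M T Y =
      distr (distr M (PiM A M' \<Otimes>\<^sub>M PiM B M') (\<lambda>\<omega>. (?A \<omega>, ?B \<omega>))) (S \<Otimes>\<^sub>M T) (\<lambda>(x, y). (f x, g y))"
    unfolding W Y by (subst pair_measure_distr) (auto simp: D)
  also have "\<dots> = distr M (S \<Otimes>\<^sub>M T) (\<lambda>\<omega>. (W \<omega>, Y \<omega>))"
    by (subst distr_distr) (auto simp: W_def Y_def comp_def)
  finally show ?thesis .
qed

section \<open>Maximisers over a finite set\<close>

text \<open>\<open>arg_max_on\<close> is a Hilbert choice, so it has the expected properties once
  some maximiser exists; a preimage of the maximum of the image is one.\<close>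

lemma finite_arg_max_on:
  fixes f :: "'b \<Rightarrow> 'c :: linorder"
  assumes "finite A" "A \<noteq> {}"
  shows "arg_max_on f A \<in> A" and "\<And>x. x \<in> A \<Longrightarrow> f x \<le> f (arg_max_on f A)"
proof -
  have "Max (f ` A) \<in> f ` A"
    using assms by simp
  then obtain m where m: "Max (f ` A) = f m" "m \<in> A"
    by (rule imageE)
  have "f x \<le> f m" if "x \<in> A" for x
    using that assms by (simp flip: m(1))
  with m(2) have "is_arg_max f (\<lambda>x. x \<in> A) m"
    by (simp add: is_arg_max_linorder)
  then have "is_arg_max f (\<lambda>x. x \<in> A) (arg_max_on f A)"
    unfolding arg_max_on_def arg_max_def by (rule someI)
  then show "arg_max_on f A \<in> A" and "\<And>x. x \<in> A \<Longrightarrow> f x \<le> f (arg_max_on f A)"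
    by (simp_all add: is_arg_max_linorder)
qed

section \<open>The relay system: parameters and measurability\<close>

context
  fixes S :: "'a relay_system" and eh :: protocol and \<rho> :: real
  assumes model: "channel_model S" and rho: "0 < \<rho>" "\<rho> < 1"
begin

interpretation prob_space "prob_sp S"
  using model unfolding channel_model_def by blast

lemma parameters_pos:
  "antennas S \<ge> 1" "lam_sr S > 0" "lam_sd S > 0" "lam_sp S > 0"
  "interference_limit S > 0" "noise_power S > 0" "gamma_th S > 0" "psi S > 0"
  "xi eh \<rho> > 0" "beta S eh \<rho> > 0"
proof -
  show "antennas S \<ge> 1" "lam_sr S > 0" "lam_sd S > 0" "lam_sp S > 0"
    and pos: "interference_limit S > 0" "noise_power S > 0"
    using model unfolding channel_model_def by blast+
  have "target_rate S > 0" "efficiency S > 0"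
    using model unfolding channel_model_def by blast+
  with rho show "gamma_th S > 0" "xi eh \<rho> > 0" "beta S eh \<rho> > 0"
    by (cases eh; simp add: gamma_th_def)+
  with pos show "psi S > 0"
    by (simp add: psi_def)
qed

lemma distributed_coefficient:
  "l \<in> links (antennas S) \<Longrightarrow>
    distributed (prob_sp S) lborel (coefficient S l) (complex_normal_density (1 / rate S l))"
  using model unfolding channel_model_def by blast

lemma indep_coefficients: "indep_vars (\<lambda>_. borel) (coefficient S) (links (antennas S))"
  using model unfolding channel_model_def by blast

lemma measurable_coefficient: "l \<in> links (antennas S) \<Longrightarrow> random_variable borel (coefficient S l)"
  using distributed_measurable[OF distributed_coefficient] by simp

lemma measurable_channels[measurable]:
  "random_variable borel (h_sd S)" "random_variable borel (g_sp S)"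
  "i \<in> {1..antennas S} \<Longrightarrow> random_variable borel (h_sr S i)"
  "i \<in> {1..antennas S} \<Longrightarrow> random_variable borel (h_rd S i)"
  "i \<in> {1..antennas S} \<Longrightarrow> random_variable borel (g_rp S i)"
  using measurable_coefficient[of SD] measurable_coefficient[of SP] measurable_coefficient[of "SR i"]
    measurable_coefficient[of "RD i"] measurable_coefficient[of "RP i"]
  by (auto simp: links_def)

lemma measurable_snrs[measurable]:
  "random_variable borel (sr_gain S)"
  "random_variable borel (source_power S)"
  "random_variable borel (snr_direct S)"
  "random_variable borel (snr_relay S eh \<rho>)"
  "j \<in> {1..antennas S} \<Longrightarrow> random_variable borel (snr_dest S eh \<rho> j)"
proof -
  show sr[measurable]: "random_variable borel (sr_gain S)"
    unfolding sr_gain_def[abs_def] by measurable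
  show sp[measurable]: "random_variable borel (source_power S)"
    unfolding source_power_def[abs_def] by measurable
  show sd[measurable]: "random_variable borel (snr_direct S)"
    unfolding snr_direct_def[abs_def] by measurable
  show "random_variable borel (snr_relay S eh \<rho>)"
    unfolding snr_relay_def[abs_def] by measurable
  show "random_variable borel (snr_dest S eh \<rho> j)" if [measurable]: "j \<in> {1..antennas S}"
    unfolding snr_dest_def[abs_def] by measurable
qed

section \<open>Antenna selection, outage and the throughput identity\<close>

text \<open>This eliminates the choice of antenna: threshold events become finite unions, so they
  are measurable without any argument about \<open>best_antenna\<close> as a function of the sample
  point, and ties do not matter.\<close>

lemma snr_best_ge_iff: "t \<le> snr_best S eh \<rho> \<omega> \<longleftrightarrow> (\<exists>j\<in>{1..antennas S}. t \<le> snr_dest S eh \<rho> j \<omega>)"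
proof -
  have "{1..antennas S} \<noteq> {}"
    using parameters_pos(1) by simp
  from finite_arg_max_on[OF finite_atLeastAtMost this, where f = "\<lambda>j. snr_dest S eh \<rho> j \<omega>"]
  show ?thesis
    unfolding snr_best_def best_antenna_def by (meson order_trans)
qed

lemma measurable_snr_best_ge[measurable]: "{\<omega>\<in>space (prob_sp S). t \<le> snr_best S eh \<rho> \<omega>} \<in> events"
  unfolding snr_best_ge_iff by measurable

text \<open>Antenna 1 serves as the witness. Both arguments of the minimum in its relayed term are
  nonnegative, also where a quotient takes its default value 0.\<close>

lemma snr_direct_le_best: "snr_direct S \<omega> \<le> snr_best S eh \<rho> \<omega>"
proof -
  have "0 \<le> sr_gain S \<omega>"
    by (simp add: sr_gain_def sum_nonneg)
  then have "snr_direct S \<omega> \<le> snr_dest S eh \<rho> 1 \<omega>"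
    using parameters_pos by (simp add: snr_dest_def source_power_def)
  then show ?thesis
    using parameters_pos(1) by (subst snr_best_ge_iff) auto
qed

lemma one_minus_outage:
  "1 - outage S eh \<rho> =
    \<P>(\<omega> in prob_sp S. snr_direct S \<omega> < gamma_th S \<and>
       snr_relay S eh \<rho> \<omega> \<ge> gamma_th S \<and> snr_best S eh \<rho> \<omega> \<ge> gamma_th S) + p3 S eh \<rho>"
proof -
  let ?O = "{\<omega>\<in>space (prob_sp S). min (snr_relay S eh \<rho> \<omega>) (snr_best S eh \<rho> \<omega>) < gamma_th S}"
  let ?A = "{\<omega>\<in>space (prob_sp S). snr_direct S \<omega> < gamma_th S \<and>
       snr_relay S eh \<rho> \<omega> \<ge> gamma_th S \<and> snr_best S eh \<rho> \<omega> \<ge> gamma_th S}"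
  let ?B = "{\<omega>\<in>space (prob_sp S). snr_direct S \<omega> \<ge> gamma_th S \<and> snr_relay S eh \<rho> \<omega> \<ge> gamma_th S}"
  \<comment> \<open>No outage splits into the disjoint events \<open>?A\<close> and
    \<open>?B\<close> according to the direct link; on \<open>?B\<close> the condition on
    \<open>snr_best\<close> follows from \<open>snr_direct_le_best\<close>.\<close>
  have eq: "?O = space (prob_sp S) - (?A \<union> ?B)"
    using order_trans[OF _ snr_direct_le_best, where x = "gamma_th S"]
    by (auto simp: min_less_iff_disj simp flip: not_le)
  have "?A \<in> events" "?B \<in> events"
    by measurable
  then show ?thesis
    unfolding outage_def p3_def eq
    by (subst prob_compl) (auto intro!: finite_measure_Union)
qed

lemma incremental_eq_cooperative_plus:
  "incremental_throughput S eh \<rho> =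
    throughput S eh \<rho> - 1 / 2 * zeta eh \<rho> * target_rate S * p3 S eh \<rho>
    + zeta eh \<rho> * target_rate S * \<P>(\<omega> in prob_sp S. snr_direct S \<omega> \<ge> gamma_th S)"
  unfolding incremental_throughput_def throughput_def one_minus_outage by (simp add: algebra_simps)

section \<open>Laws and independence of the squared gains\<close>

lemma gain_distributed:
  "distributed (prob_sp S) lborel (\<lambda>\<omega>. (cmod (g_sp S \<omega>))\<^sup>2) (exponential_density (lam_sp S))"
  "distributed (prob_sp S) lborel (\<lambda>\<omega>. (cmod (h_sd S \<omega>))\<^sup>2) (exponential_density (lam_sd S))"
  "i \<in> {1..antennas S} \<Longrightarrow>
    distributed (prob_sp S) lborel (\<lambda>\<omega>. (cmod (h_sr S i \<omega>))\<^sup>2) (exponential_density (lam_sr S))"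
  using distributed_cmod_square[OF distributed_coefficient[of SP]]
    distributed_cmod_square[OF distributed_coefficient[of SD]]
    distributed_cmod_square[OF distributed_coefficient[of "SR i"]] parameters_pos
  by (auto simp: links_def)

text \<open>These are the independence hypotheses of the two comparison lemmas. Each comes from two
  disjoint sets of links; in the last, the pair is a function of the block
  \<open>insert SP ?SR\<close>.\<close>

lemma product_distr_gains:
  defines "X \<equiv> \<lambda>\<omega>. (cmod (g_sp S \<omega>))\<^sup>2" and "Y \<equiv> \<lambda>\<omega>. (cmod (h_sd S \<omega>))\<^sup>2" and "Z \<equiv> sr_gain S"
  shows "distr (prob_sp S) borel X \<Otimes>\<^sub>M distr (prob_sp S) borel Y =
      distr (prob_sp S) (borel \<Otimes>\<^sub>M borel) (\<lambda>\<omega>. (X \<omega>, Y \<omega>))"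
    and "distr (prob_sp S) borel Z \<Otimes>\<^sub>M distr (prob_sp S) borel X =
      distr (prob_sp S) (borel \<Otimes>\<^sub>M borel) (\<lambda>\<omega>. (Z \<omega>, X \<omega>))"
    and "distr (prob_sp S) (borel \<Otimes>\<^sub>M borel) (\<lambda>\<omega>. (X \<omega>, Z \<omega>)) \<Otimes>\<^sub>M distr (prob_sp S) borel Y =
      distr (prob_sp S) ((borel \<Otimes>\<^sub>M borel) \<Otimes>\<^sub>M borel) (\<lambda>\<omega>. ((X \<omega>, Z \<omega>), Y \<omega>))"
proof -
  note indep = distr_pair_functions_restrict[OF indep_coefficients]
  let ?SR = "SR ` {1..antennas S}"
  have l: "SP \<in> links (antennas S)" "SD \<in> links (antennas S)" "?SR \<subseteq> links (antennas S)"
    and disj: "SP \<notin> ?SR" "SD \<notin> ?SR"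
    by (auto simp: links_def)
  have Z: "Z = (\<lambda>\<omega>. \<Sum>i\<in>{1..antennas S}. (cmod (h_sr S i \<omega>))\<^sup>2)"
    by (simp add: Z_def sr_gain_def[abs_def])
  show "distr (prob_sp S) borel X \<Otimes>\<^sub>M distr (prob_sp S) borel Y =
      distr (prob_sp S) (borel \<Otimes>\<^sub>M borel) (\<lambda>\<omega>. (X \<omega>, Y \<omega>))"
    using l disj indep[of "{SP}" "{SD}" "\<lambda>c. (cmod (c SP))\<^sup>2" borel "\<lambda>c. (cmod (c SD))\<^sup>2" borel]
    by (simp add: X_def Y_def)
  show "distr (prob_sp S) borel Z \<Otimes>\<^sub>M distr (prob_sp S) borel X =
      distr (prob_sp S) (borel \<Otimes>\<^sub>M borel) (\<lambda>\<omega>. (Z \<omega>, X \<omega>))"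
    using l disj indep[of ?SR "{SP}"
        "\<lambda>c. \<Sum>i\<in>{1..antennas S}. (cmod (c (SR i)))\<^sup>2" borel "\<lambda>c. (cmod (c SP))\<^sup>2" borel]
    by (simp add: X_def Z)
  show "distr (prob_sp S) (borel \<Otimes>\<^sub>M borel) (\<lambda>\<omega>. (X \<omega>, Z \<omega>)) \<Otimes>\<^sub>M distr (prob_sp S) borel Y =
      distr (prob_sp S) ((borel \<Otimes>\<^sub>M borel) \<Otimes>\<^sub>M borel) (\<lambda>\<omega>. ((X \<omega>, Z \<omega>), Y \<omega>))"
    using l disj indep[of "insert SP ?SR" "{SD}"
        "\<lambda>c. ((cmod (c SP))\<^sup>2, \<Sum>i\<in>{1..antennas S}. (cmod (c (SR i)))\<^sup>2)" "borel \<Otimes>\<^sub>M borel"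
        "\<lambda>c. (cmod (c SD))\<^sup>2" borel]
    by (simp add: X_def Y_def Z)
qed

section \<open>Probabilities of the direct and relay events\<close>

text \<open>Clearing denominators gathers the constants into \<open>psi S\<close>. Both equivalences
  fail where \<open>g_sp\<close> vanishes: the SNRs are then 0, below the threshold, while the
  right-hand inequalities hold.\<close>

lemma snr_ge_iff:
  assumes "g_sp S \<omega> \<noteq> 0"
  shows "gamma_th S \<le> snr_direct S \<omega> \<longleftrightarrow> psi S * (cmod (g_sp S \<omega>))\<^sup>2 \<le> (cmod (h_sd S \<omega>))\<^sup>2"
    and "gamma_th S \<le> snr_relay S eh \<rho> \<omega> \<longleftrightarrow> (cmod (g_sp S \<omega>))\<^sup>2 \<le> xi eh \<rho> / psi S * sr_gain S \<omega>"
  using parameters_pos assms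
  by (auto simp: snr_direct_def snr_relay_def source_power_def psi_def field_simps)

lemma AE_g_sp_nonzero: "AE \<omega> in prob_sp S. g_sp S \<omega> \<noteq> 0"
  using distributed_lborel_AE_neq[OF gain_distributed(1), of 0] by simp

lemma prob_direct: "\<P>(\<omega> in prob_sp S. gamma_th S \<le> snr_direct S \<omega>) = 1 / (1 + lam_sd S * psi S / lam_sp S)"
proof -
  have "\<P>(\<omega> in prob_sp S. gamma_th S \<le> snr_direct S \<omega>) =
      \<P>(\<omega> in prob_sp S. psi S * (cmod (g_sp S \<omega>))\<^sup>2 \<le> (cmod (h_sd S \<omega>))\<^sup>2)"
    using AE_g_sp_nonzero by (intro prob_eq_AE) (auto simp: snr_ge_iff(1))
  also have "\<dots> = lam_sp S / (lam_sp S + lam_sd S * psi S)"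
    using parameters_pos
    by (intro prob_exponential_ratio_ge gain_distributed product_distr_gains) auto
  also have "\<dots> = 1 / (1 + lam_sd S * psi S / lam_sp S)"
    using parameters_pos by (simp add: field_simps)
  finally show ?thesis .
qed

lemma sr_gain_laplace_transform:
  assumes "0 \<le> s"
  shows "expectation (\<lambda>\<omega>. exp (- s * sr_gain S \<omega>)) = (lam_sr S / (lam_sr S + s)) ^ antennas S"
proof -
  have "indep_vars (\<lambda>_. borel) (\<lambda>l \<omega>. (cmod (coefficient S l \<omega>))\<^sup>2) (SR ` {1..antennas S})"
    using indep_vars_subset[OF indep_coefficients]
    by (intro indep_vars_compose2[where Y = "\<lambda>_ z. (cmod z)\<^sup>2"]) (auto simp: links_def)
  \<comment> \<open>The independent family is indexed by links; injectivity of \<open>SR\<close>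
    carries the sum and the cardinality back to antenna numbers.\<close>
  moreover have "inj_on SR {1..antennas S}"
    by (simp add: inj_on_def)
  moreover have "distributed (prob_sp S) lborel (\<lambda>\<omega>. (cmod (coefficient S l \<omega>))\<^sup>2)
      (exponential_density (lam_sr S))" if "l \<in> SR ` {1..antennas S}" for l
    using that gain_distributed(3) by auto
  ultimately show ?thesis
    using laplace_transform_sum_exponential[of "SR ` {1..antennas S}"
        "\<lambda>l \<omega>. (cmod (coefficient S l \<omega>))\<^sup>2" "lam_sr S" s] parameters_pos assms
    by (simp add: sr_gain_def sum.reindex card_image)
qed

lemma p3_eq:
  "p3 S eh \<rho> = 1 / (1 + lam_sd S * psi S / lam_sp S) *
    (1 - (1 + lam_sd S * xi eh \<rho> / lam_sr S + lam_sp S * xi eh \<rho> / (lam_sr S * psi S))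
           powi (- int (antennas S)))"
proof -
  \<comment> \<open>This is \<open>(a + b * k) * c\<close> of
    \<open>prob_exponential_ratio_ge_le\<close> for \<open>a = lam_sp S\<close>,
    \<open>b = lam_sd S\<close>, \<open>k = psi S\<close> and
    \<open>c = xi eh \<rho> / psi S\<close>.\<close>
  let ?s = "(lam_sp S + lam_sd S * psi S) * (xi eh \<rho> / psi S)"
  have "p3 S eh \<rho> = \<P>(\<omega> in prob_sp S. psi S * (cmod (g_sp S \<omega>))\<^sup>2 \<le> (cmod (h_sd S \<omega>))\<^sup>2 \<and>
      (cmod (g_sp S \<omega>))\<^sup>2 \<le> xi eh \<rho> / psi S * sr_gain S \<omega>)"
    unfolding p3_def using AE_g_sp_nonzero by (intro prob_eq_AE) (auto simp: snr_ge_iff)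
  also have "\<dots> = lam_sp S / (lam_sp S + lam_sd S * psi S) *
      (1 - expectation (\<lambda>\<omega>. exp (- ?s * sr_gain S \<omega>)))"
    using parameters_pos
    by (intro prob_exponential_ratio_ge_le gain_distributed product_distr_gains)
       (auto simp: sr_gain_def sum_nonneg)
  also have "expectation (\<lambda>\<omega>. exp (- ?s * sr_gain S \<omega>)) = (lam_sr S / (lam_sr S + ?s)) ^ antennas S"
    using parameters_pos by (intro sr_gain_laplace_transform) simp
  \<comment> \<open>Dividing through by \<open>lam_sr S\<close> and expanding \<open>?s\<close>
    produces the base of the power in the theorem.\<close>
  also have "lam_sr S / (lam_sr S + ?s) =
      inverse (1 + lam_sd S * xi eh \<rho> / lam_sr S + lam_sp S * xi eh \<rho> / (lam_sr S * psi S))"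
    using parameters_pos by (simp add: divide_simps) (simp add: algebra_simps)
  also have "lam_sp S / (lam_sp S + lam_sd S * psi S) = 1 / (1 + lam_sd S * psi S / lam_sp S)"
    using parameters_pos by (simp add: field_simps)
  finally show ?thesis
    by (simp add: power_int_minus power_inverse)
qed

end

theorem lemmaV4:
  fixes S :: "'a relay_system" and eh :: protocol and \<rho> :: real
  assumes "channel_model S" and "0 < \<rho>" and "\<rho> < 1"
  shows "incremental_throughput S eh \<rho> =
           throughput S eh \<rho> - 1 / 2 * zeta eh \<rho> * target_rate S * p3 S eh \<rho>
           + zeta eh \<rho> * target_rate S / (1 + lam_sd S * psi S / lam_sp S)
       \<and> incremental_throughput S eh \<rho> =
           throughput S eh \<rho>
           + (1 / 2 * zeta eh \<rho> * target_rate S) / (1 + lam_sd S * psi S / lam_sp S) *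
             (1 + (1 + lam_sd S * xi eh \<rho> / lam_sr S + lam_sp S * xi eh \<rho> / (lam_sr S * psi S))
                    powi (- int (antennas S)))"
proof -
  have first: "incremental_throughput S eh \<rho> =
      throughput S eh \<rho> - 1 / 2 * zeta eh \<rho> * target_rate S * p3 S eh \<rho>
      + zeta eh \<rho> * target_rate S / (1 + lam_sd S * psi S / lam_sp S)"
    using incremental_eq_cooperative_plus[OF assms] unfolding prob_direct[OF assms]
    by (simp only: times_divide_eq_right mult_1_right)
  \<comment> \<open>With \<open>q\<close> the power term, half of \<open>z * r / d * (1 - q)\<close>
    is taken from the whole \<open>z * r / d\<close>, which leaves half of
    \<open>z * r / d * (1 + q)\<close>. Stated for arbitrary reals, it serves as a rewrite rule
    turning the first form into the second after \<open>p3_eq\<close>.\<close>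
  have halves: "t - 1 / 2 * z * r * (1 / d * (1 - q)) + z * r / d = t + 1 / 2 * z * r / d * (1 + q)"
    for t z r d q :: real
    by (simp add: right_diff_distrib distrib_left diff_divide_distrib add_divide_distrib)
  from first show ?thesis
    using first[unfolded p3_eq[OF assms] halves] by (rule conjI)
qed

end
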